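(* Let $n\ge1$, let $\mathbb{X}$ be an $n$-dimensional smooth real Banach space and let $\mathcal{A}\subset\mathbb{X}\setminus\{0\}$ be a compact set. Then $\mathcal{A}$ admits a ball covering consisting of $n+1$ balls. In particular, $S_{\mathbb{X}}$ admits a ball covering consisting of $n+1$ balls.
   Context: $S_{\mathbb{X}}$ is the unit sphere. $\mathbb{X}$ is smooth if every $x\in S_{\mathbb{X}}$ has exactly one norm-one functional $x^*\in\mathbb{X}^*$ with $x^*(x)=\|x\|$. A set $\mathcal{A}\subset\mathbb{X}$ admits a ball covering consisting of $k$ balls if there are $x_1,\dots,x_k\in\mathbb{X}\setminus\{0\}$ and $0<r_i\le\|x_i\|$ with $\mathcal{A}\subseteq\bigcup_{i=1}^k B(x_i,r_i)$, where $B(x,r)$ is the open ball of center $x$ and radius $r$. *)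

theory Defs
  imports "HOL-Analysis.Analysis"
begin

text \<open>The dual space is the type of bounded linear maps into the reals,
  whose norm is the operator norm.\<close>

definition smooth_space :: "'a::real_normed_vector itself \<Rightarrow> bool" where
  "smooth_space _ \<longleftrightarrow>
    (\<forall>x \<in> sphere (0::'a) 1. \<exists>!f :: 'a \<Rightarrow>\<^sub>L real. norm f = 1 \<and> blinfun_apply f x = norm x)"

definition admits_ball_covering :: "nat \<Rightarrow> 'a::real_normed_vector set \<Rightarrow> bool" where
  "admits_ball_covering k A \<longleftrightarrow>
    (\<exists>(x :: nat \<Rightarrow> 'a) (r :: nat \<Rightarrow> real).
      (\<forall>i\<in>{1..k}. x i \<noteq> 0 \<and> 0 < r i \<and> r i \<le> norm (x i)) \<and>
      A \<subseteq> (\<Union>i\<in>{1..k}. ball (x i) (r i)))"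

end

theory Submission
  imports Defs
begin

text \<open>
  If \<open>y\<close> is a unit vector, the balls \<open>ball (t *\<^sub>R y) t\<close> all have the origin on their boundary and
  increase with \<open>t\<close>. A vector \<open>z\<close> lies in one of them iff \<open>norm (y - s *\<^sub>R z) < 1\<close> for some
  \<open>s > 0\<close>, that is, iff the norm can be decreased from \<open>y\<close> by moving in the direction \<open>- z\<close>.
  In a smooth space this happens as soon as \<open>f z > 0\<close>, where \<open>f\<close> is the support functional at
  \<open>y\<close> (\<open>smooth_norm_descent\<close>). So the union of the balls contains the open half space
  \<open>{z. f z > 0}\<close>.

  It remains to cover the complement of the origin by \<open>n + 1\<close> open half spaces
  that belong to support functionals. The \<open>n\<close> coordinate functionals of a basis together
  with the negative of their sum do this, because a vector at which none of them is positive has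
  only zero coordinates (\<open>positive_functionals_finite_dim\<close>). Each of them is, up to a positive
  factor, the support functional at some unit vector, since the unit sphere is compact and a linear
  functional attains its norm there (\<open>functional_attains_norm\<close>). A compact set that avoids the
  origin is thus covered by increasing families of balls in \<open>n + 1\<close> directions, and finitely many
  radii, hence the largest of them, suffice (\<open>admits_ball_covering_of_directions\<close>).

  The descent property is proved by contradiction. If no step in the direction \<open>- z\<close> decreases the norm,
  then the Hahn--Banach theorem gives a second support functional \<open>g\<close> at \<open>y\<close> with \<open>g z \<le> 0\<close>,
  against smoothness. Both the constraint \<open>g z \<le> 0\<close> and the Hahn--Banach theorem itself come
  from one construction, which lowers a sublinear function in a prescribed direction
  (\<open>sublinear_tilt\<close>).
\<close>

section \<open>Sublinear functions and the Hahn--Banach theorem\<close>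

definition sublinear :: "('a::real_vector \<Rightarrow> real) \<Rightarrow> bool" where
  "sublinear p \<longleftrightarrow> (\<forall>x y. p (x + y) \<le> p x + p y) \<and> (\<forall>k\<ge>0. \<forall>x. p (k *\<^sub>R x) = k * p x)"

lemma sublinear_add: "sublinear p \<Longrightarrow> p (x + y) \<le> p x + p y"
  and sublinear_scale: "sublinear p \<Longrightarrow> 0 \<le> k \<Longrightarrow> p (k *\<^sub>R x) = k * p x"
  unfolding sublinear_def by auto

lemma sublinear_zero: "sublinear p \<Longrightarrow> p 0 = 0"
  using sublinear_scale[of p 0 0] by simp

lemma sublinear_minus: "sublinear p \<Longrightarrow> - p (- x) \<le> p x"
  using sublinear_add[of p x "- x"] sublinear_zero[of p] by simp

text \<open>Scaling by \<open>k\<close> and by its inverse turns the inequality into an equality, and the factors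
  \<open>2\<close> and \<open>1 / 2\<close> force the value at the origin to vanish.\<close>

lemma sublinearI:
  assumes add: "\<And>x y. p (x + y) \<le> p x + p y"
    and scale: "\<And>k x. 0 < k \<Longrightarrow> p (k *\<^sub>R x) \<le> k * p x"
  shows "sublinear p"
proof -
  have "p (k *\<^sub>R x) = k * p x" if "0 \<le> k" for k x
  proof (cases "k = 0")
    case True
    have "p 0 \<le> 2 * p 0" "p 0 \<le> (1 / 2) * p 0"
      using scale[of 2 0] scale[of "1 / 2" 0] by simp_all
    then show ?thesis
      using True by simp
  next
    case False
    then have "0 < k"
      using that by simp
    have "p x \<le> inverse k * p (k *\<^sub>R x)"
      using scale[of "inverse k" "k *\<^sub>R x"] \<open>0 < k\<close> by simp
    then have "k * p x \<le> p (k *\<^sub>R x)"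
      using \<open>0 < k\<close> by (simp add: field_simps)
    then show ?thesis
      using scale[OF \<open>0 < k\<close>, of x] by simp
  qed
  then show ?thesis
    unfolding sublinear_def using add by blast
qed

text \<open>The function \<open>q\<close> is the largest sublinear function below \<open>p\<close> whose value at \<open>- v\<close> is at most
  \<open>- c\<close>: any such function \<open>r\<close> satisfies \<open>r x \<le> r (x + s *\<^sub>R v) + s * r (- v)
  \<le> p (x + s *\<^sub>R v) - s * c\<close> for \<open>s \<ge> 0\<close>, and \<open>q\<close> is the infimum of these bounds. The assumption
  \<open>c \<le> p v\<close> keeps the infimum finite. The choice \<open>c = p v\<close> makes the function additive on the
  pair \<open>v\<close>, \<open>- v\<close>, and the choice \<open>c = 0\<close> makes it nonpositive at \<open>- v\<close>.\<close>

lemma sublinear_tilt: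
  fixes p :: "'a::real_vector \<Rightarrow> real"
  assumes p: "sublinear p" and c: "c \<le> p v"
  obtains q where "sublinear q" "\<And>x. q x \<le> p x" "q (- v) \<le> - c"
    and "\<forall>x m. (\<forall>s\<ge>0. m \<le> p (x + s *\<^sub>R v) - s * c) \<longrightarrow> m \<le> q x"
proof -
  define q where "q x = (INF s\<in>{0..}. p (x + s *\<^sub>R v) - s * c)" for x
  have bdd: "bdd_below ((\<lambda>s. p (x + s *\<^sub>R v) - s * c) ` {0..})" for x
  proof (rule bdd_belowI2)
    fix s :: real assume "s \<in> {0..}"
    then have "s * c \<le> s * p v" "p (s *\<^sub>R v) = s * p v"
      using c sublinear_scale[OF p] by (auto intro: mult_left_mono)
    moreover have "p (s *\<^sub>R v) \<le> p (x + s *\<^sub>R v) + p (- x)"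
      using sublinear_add[OF p, of "x + s *\<^sub>R v" "- x"] by simp
    ultimately show "- p (- x) \<le> p (x + s *\<^sub>R v) - s * c"
      by linarith
  qed
  have q_le: "q x \<le> p (x + s *\<^sub>R v) - s * c" if "0 \<le> s" for x s
    unfolding q_def using that by (intro cINF_lower bdd) auto
  have q_ge: "m \<le> q x" if "\<And>s. 0 \<le> s \<Longrightarrow> m \<le> p (x + s *\<^sub>R v) - s * c" for x m
    unfolding q_def using that by (intro cINF_greatest) auto
  have "sublinear q"
  proof (rule sublinearI)
    fix x y
    have "q (x + y) - (p (x + s *\<^sub>R v) - s * c) \<le> q y" if s: "0 \<le> s" for s
    proof (rule q_ge)
      fix t :: real assume t: "0 \<le> t"
      have "q (x + y) \<le> p ((x + y) + (s + t) *\<^sub>R v) - (s + t) * c"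
        using s t by (intro q_le) simp
      also have "(x + y) + (s + t) *\<^sub>R v = (x + s *\<^sub>R v) + (y + t *\<^sub>R v)"
        by (simp add: algebra_simps)
      also have "p \<dots> \<le> p (x + s *\<^sub>R v) + p (y + t *\<^sub>R v)"
        by (rule sublinear_add[OF p])
      finally show "q (x + y) - (p (x + s *\<^sub>R v) - s * c) \<le> p (y + t *\<^sub>R v) - t * c"
        by (simp add: algebra_simps)
    qed
    then have "q (x + y) - q y \<le> q x"
      by (intro q_ge) (simp add: algebra_simps)
    then show "q (x + y) \<le> q x + q y"
      by simp
  next
    fix k :: real and x assume k: "0 < k"
    have "q (k *\<^sub>R x) / k \<le> q x"
    proof (rule q_ge)
      fix s :: real assume s: "0 \<le> s"
      have "q (k *\<^sub>R x) \<le> p (k *\<^sub>R x + (k * s) *\<^sub>R v) - (k * s) * c"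
        using k s by (intro q_le) simp
      also have "k *\<^sub>R x + (k * s) *\<^sub>R v = k *\<^sub>R (x + s *\<^sub>R v)"
        by (simp add: algebra_simps)
      also have "p \<dots> = k * p (x + s *\<^sub>R v)"
        using k by (intro sublinear_scale[OF p]) simp
      finally show "q (k *\<^sub>R x) / k \<le> p (x + s *\<^sub>R v) - s * c"
        using k by (simp add: field_simps)
    qed
    then show "q (k *\<^sub>R x) \<le> k * q x"
      using k by (simp add: field_simps)
  qed
  moreover have "q x \<le> p x" for x
    using q_le[of 0 x] by simp
  moreover have "q (- v) \<le> - c"
    using q_le[of 1 "- v"] sublinear_zero[OF p] by simp
  moreover have "\<forall>x m. (\<forall>s\<ge>0. m \<le> p (x + s *\<^sub>R v) - s * c) \<longrightarrow> m \<le> q x"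
    by (intro allI impI q_ge) simp
  ultimately show thesis
    by (rule that)
qed

text \<open>Subadditivity always gives \<open>p (- x) \<ge> - p x\<close>, and the vectors at which equality holds form a
  subspace. If this subspace is everything, then subadditivity at \<open>x\<close>, \<open>y\<close> and at
  \<open>- x\<close>, \<open>- y\<close> give the two inequalities of additivity.\<close>

lemma sublinear_linear_if_odd:
  fixes p :: "'a::real_vector \<Rightarrow> real"
  assumes p: "sublinear p" and odd: "\<And>b. b \<in> B \<Longrightarrow> p (- b) \<le> - p b" and "span B = UNIV"
  shows "linear p"
proof -
  have minus: "p (- x) = - p x" for x
  proof -
    have "x \<in> span B"
      using assms(3) by simp
    then have "p (- x) \<le> - p x"
    proof (induction rule: span_induct_alt)
      case base
      show ?case
        using sublinear_zero[OF p] by simp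
    next
      case (step c b y)
      have b: "p (- b) = - p b"
        using odd[OF step.hyps] sublinear_minus[OF p, of b] by simp
      have "p (c *\<^sub>R b) = c * p b \<and> p (- (c *\<^sub>R b)) = - (c * p b)"
      proof (cases "0 \<le> c")
        case True
        then show ?thesis
          using b sublinear_scale[OF p, of c b] sublinear_scale[OF p, of c "- b"] by simp
      next
        case False
        then show ?thesis
          using b sublinear_scale[OF p, of "- c" b] sublinear_scale[OF p, of "- c" "- b"] by simp
      qed
      then show ?case
        using sublinear_add[OF p, of "c *\<^sub>R b" y]
          sublinear_add[OF p, of "- (c *\<^sub>R b)" "- y"] step.IH by simp
    qed
    then show ?thesis
      using sublinear_minus[OF p, of x] by simp
  qed
  show ?thesis
  proof (rule linearI)
    fix x y
    show "p (x + y) = p x + p y"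
      using sublinear_add[OF p, of x y] sublinear_add[OF p, of "- x" "- y"] minus[of x] minus[of y]
        minus[of "x + y"] by simp
  next
    fix k :: real and x
    show "p (k *\<^sub>R x) = k *\<^sub>R p x"
    proof (cases "0 \<le> k")
      case True
      then show ?thesis
        using sublinear_scale[OF p] by simp
    next
      case False
      then show ?thesis
        using sublinear_scale[OF p, of "- k" x] minus[of "k *\<^sub>R x"] by simp
    qed
  qed
qed

text \<open>Tilting along each vector \<open>b\<close> of a finite spanning set in turn, with \<open>c\<close> the current value
  at \<open>b\<close>, makes \<open>p\<close>
  odd on that set and hence linear. Oddness survives later steps: they lower both \<open>q b\<close> and
  \<open>q (- b)\<close>, whose sum is at least \<open>0\<close> and was at most \<open>0\<close> already. The value at \<open>v\<close>
  is preserved by tilting at \<open>v\<close> first, because the bound \<open>- p v\<close> at \<open>- v\<close> then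
  passes to everything below.\<close>

lemma hahn_banach_finite_dim:
  fixes p :: "'a::real_vector \<Rightarrow> real" and B :: "'a set"
  assumes p: "sublinear p" and "finite B" and "span B = UNIV"
  obtains g where "linear g" "\<And>x. g x \<le> p x" "g v = p v"
proof -
  obtain r where r: "sublinear r" "\<And>x. r x \<le> p x" "r (- v) \<le> - p v"
    by (rule sublinear_tilt[OF p order.refl, of v]) (rule that)
  have "\<exists>q. sublinear q \<and> (\<forall>x. q x \<le> r x) \<and> (\<forall>b\<in>B. q (- b) \<le> - q b)"
    using \<open>finite B\<close>
  proof induction
    case empty
    show ?case
      using r(1) by auto
  next
    case (insert a S)
    then obtain q where q: "sublinear q" "\<And>x. q x \<le> r x" "\<And>b. b \<in> S \<Longrightarrow> q (- b) \<le> - q b"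
      by blast
    obtain q' where q': "sublinear q'" "\<And>x. q' x \<le> q x" "q' (- a) \<le> - q a"
      by (rule sublinear_tilt[OF q(1) order.refl, of a]) (rule that)
    have "q' (- b) \<le> - q' b" if "b \<in> insert a S" for b
    proof (cases "b = a")
      case True
      then show ?thesis
        using q'(2)[of a] q'(3) by simp
    next
      case False
      then show ?thesis
        using that q'(2)[of b] q'(2)[of "- b"] q(3)[of b] by simp
    qed
    moreover have "q' x \<le> r x" for x
      using q'(2) q(2) by (rule order.trans)
    ultimately show ?case
      using q'(1) by blast
  qed
  then obtain g where g: "sublinear g" "\<And>x. g x \<le> r x" "\<And>b. b \<in> B \<Longrightarrow> g (- b) \<le> - g b"
    by blast
  show thesis
  proof (rule that[of g])
    show "linear g"
      using g(1,3) \<open>span B = UNIV\<close> by (rule sublinear_linear_if_odd)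
    show g_le: "g x \<le> p x" for x
      using g(2) r(2) by (rule order.trans)
    show "g v = p v"
      using g_le[of v] g(2)[of "- v"] r(3) sublinear_minus[OF g(1), of v] by simp
  qed
qed

section \<open>Support functionals in smooth spaces\<close>

lemma norm_Blinfun_eq_one:
  fixes g :: "'a::real_normed_vector \<Rightarrow> real"
  assumes "linear g" and le: "\<And>x. g x \<le> norm x" and y: "norm y = 1" "g y = 1"
  shows "blinfun_apply (Blinfun g) = g" "norm (Blinfun g) = 1"
proof -
  have abs_le: "\<bar>g x\<bar> \<le> norm x" for x
    using le[of x] le[of "- x"] linear_neg[OF \<open>linear g\<close>, of x] by simp
  have "bounded_linear g"
    using \<open>linear g\<close> abs_le by (intro bounded_linear_intro[where K = 1]) (auto simp: linear_add linear_scale)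
  then show app: "blinfun_apply (Blinfun g) = g"
    by (rule bounded_linear_Blinfun_apply)
  show "norm (Blinfun g) = 1"
  proof (rule antisym)
    show "norm (Blinfun g) \<le> 1"
      using abs_le by (intro norm_blinfun_bound) (auto simp: app)
    show "1 \<le> norm (Blinfun g)"
      using norm_blinfun[of "Blinfun g" y] y by (simp add: app)
  qed
qed

text \<open>If the norm did not drop below \<open>1\<close> on the ray from \<open>y\<close> in the direction \<open>- z\<close>, then the
  distance \<open>q x\<close> from \<open>x\<close> to the ray \<open>{s *\<^sub>R z |s. s \<ge> 0}\<close> would be a sublinear function below the norm with
  \<open>q y = 1\<close> and \<open>q z \<le> 0\<close>. A linear functional below \<open>q\<close> that agrees with it at \<open>y\<close> would
  be a support functional at \<open>y\<close> that is nonpositive at \<open>z\<close>, hence different from \<open>f\<close>.\<close>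

lemma smooth_norm_descent:
  fixes y z :: "'a::real_normed_vector"
  assumes smooth: "smooth_space TYPE('a)" and B: "finite B" "span B = (UNIV :: 'a set)"
    and f: "linear f" "\<And>x. f x \<le> norm x" and y: "norm y = 1" "f y = 1" and z: "0 < f z"
  obtains s where "0 < s" "norm (y - s *\<^sub>R z) < 1"
proof -
  have "\<exists>s>0. norm (y - s *\<^sub>R z) < 1"
  proof (rule ccontr)
    assume "\<not> ?thesis"
    then have far: "1 \<le> norm (y - s *\<^sub>R z)" if "0 < s" for s
      using that by force
    \<comment> \<open>the tilt of the norm by \<open>c = 0\<close> along \<open>- z\<close> is the distance to the ray through \<open>z\<close>\<close>
    have "sublinear (norm :: 'a \<Rightarrow> real)"
      by (rule sublinearI) (auto simp: norm_triangle_ineq)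
    moreover have "0 \<le> norm (- z)"
      by simp
    ultimately obtain q where q: "sublinear q" "\<And>x. q x \<le> norm x" "q (- (- z)) \<le> - 0"
      and q_ge: "\<forall>x m. (\<forall>s\<ge>0. m \<le> norm (x + s *\<^sub>R (- z)) - s * 0) \<longrightarrow> m \<le> q x"
      by (rule sublinear_tilt) (rule that)
    have "1 \<le> norm (y + s *\<^sub>R (- z)) - s * 0" if "0 \<le> s" for s
      using far[of s] that y by (cases "s = 0") auto
    then have "\<forall>s\<ge>0. 1 \<le> norm (y + s *\<^sub>R (- z)) - s * 0"
      by simp
    then have "1 \<le> q y"
      by (rule q_ge[THEN spec, THEN spec, THEN mp])
    then have "q y = 1"
      using q(2)[of y] y by simp
    obtain g where g: "linear g" "\<And>x. g x \<le> q x" "g y = q y"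
      using hahn_banach_finite_dim[OF q(1) B] by blast
    have g_le: "g x \<le> norm x" for x
      using g(2) q(2) by (rule order.trans)
    have "g y = 1"
      using g(3) \<open>q y = 1\<close> by simp
    note g_blinfun = norm_Blinfun_eq_one[OF g(1) g_le y(1) this]
    note f_blinfun = norm_Blinfun_eq_one[OF f y]
    have "\<exists>!h :: 'a \<Rightarrow>\<^sub>L real. norm h = 1 \<and> blinfun_apply h y = norm y"
      using smooth y(1) by (simp add: smooth_space_def)
    then obtain h :: "'a \<Rightarrow>\<^sub>L real"
      where unique: "\<And>k. norm k = 1 \<and> blinfun_apply k y = norm y \<Longrightarrow> k = h"
      by (auto elim!: ex1E)
    have "Blinfun g = h"
      using unique[of "Blinfun g"] g_blinfun y(1) \<open>g y = 1\<close> by simp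
    moreover have "Blinfun f = h"
      using unique[of "Blinfun f"] f_blinfun y by simp
    ultimately have "blinfun_apply (Blinfun g) = blinfun_apply (Blinfun f)"
      by simp
    then have "g = f"
      by (simp only: f_blinfun(1) g_blinfun(1))
    then show False
      using z g(2)[of z] q(3) by simp
  qed
  then show thesis
    using that by blast
qed

section \<open>Compactness in finite dimension\<close>

lemma compact_combinations:
  fixes B :: "'a::real_normed_vector set"
  assumes "finite B" and "\<And>b. b \<in> B \<Longrightarrow> compact (K b)"
  shows "compact {\<Sum>b\<in>B. u b *\<^sub>R b | u. \<forall>b\<in>B. u b \<in> K b}"
  using assms
proof induction
  case empty
  show ?case
    by simp
next
  case (insert a S)
  let ?C = "\<lambda>S. {\<Sum>b\<in>S. u b *\<^sub>R b | u. \<forall>b\<in>S. u b \<in> K b}"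
  have "?C (insert a S) = {x + y | x y. x \<in> (\<lambda>k. k *\<^sub>R a) ` K a \<and> y \<in> ?C S}"
  proof (intro equalityI subsetI)
    fix x assume "x \<in> ?C (insert a S)"
    then show "x \<in> {x + y | x y. x \<in> (\<lambda>k. k *\<^sub>R a) ` K a \<and> y \<in> ?C S}"
      using insert.hyps by fastforce
  next
    fix x assume "x \<in> {x + y | x y. x \<in> (\<lambda>k. k *\<^sub>R a) ` K a \<and> y \<in> ?C S}"
    then obtain k u where x: "x = k *\<^sub>R a + (\<Sum>b\<in>S. u b *\<^sub>R b)" "k \<in> K a" "\<forall>b\<in>S. u b \<in> K b"
      by auto
    have "(\<Sum>b\<in>S. u b *\<^sub>R b) = (\<Sum>b\<in>S. (u(a := k)) b *\<^sub>R b)"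
      using insert.hyps by (intro sum.cong) auto
    then have "x = (\<Sum>b\<in>insert a S. (u(a := k)) b *\<^sub>R b)"
      using x(1) insert.hyps by simp
    moreover have "\<forall>b\<in>insert a S. (u(a := k)) b \<in> K b"
      using x(2,3) by simp
    ultimately show "x \<in> ?C (insert a S)"
      by blast
  qed
  moreover have "compact ((\<lambda>k. k *\<^sub>R a) ` K a)"
    using insert.prems by (intro compact_continuous_image continuous_intros) auto
  ultimately show ?case
    using insert compact_sums[of "(\<lambda>k. k *\<^sub>R a) ` K a" "?C S"] by (simp only: insert_iff simp_thms)
qed

text \<open>Equivalence of the given norm with the maximum norm of the coordinates. The unit sphere
  \<open>\<Union>a\<in>B. S a\<close> of the maximum norm, where \<open>S a\<close> is the pair of faces on which the coordinate at
  \<open>a\<close> is \<open>- 1\<close> or \<open>1\<close>, is compact and misses the origin, so it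
  stays at some distance \<open>d > 0\<close> from the origin, and homogeneity does the rest.\<close>

lemma representation_bound:
  fixes B :: "'a::real_normed_vector set"
  assumes B: "finite B" "independent B" "span B = UNIV"
  obtains C where "\<And>b x. b \<in> B \<Longrightarrow> \<bar>representation B x b\<bar> \<le> C * norm x"
proof -
  have sum_rep: "(\<Sum>b\<in>B. representation B x b *\<^sub>R b) = x" for x
    using B by (intro real_vector.sum_representation_eq) auto
  define S where "S a = {\<Sum>b\<in>B. u b *\<^sub>R b | u. \<forall>b\<in>B. u b \<in> (if b = a then {- 1, 1} else {- 1..1::real})}" for a
  have "compact (\<Union>a\<in>B. S a)"
    unfolding S_def using B(1) by (intro compact_UN compact_combinations) auto
  moreover have "0 \<notin> S a" if "a \<in> B" for a
  proof
    assume "0 \<in> S a"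
    then obtain u where "(\<Sum>b\<in>B. u b *\<^sub>R b) = 0" "\<forall>b\<in>B. u b \<in> (if b = a then {- 1, 1} else {- 1..1::real})"
      unfolding S_def by auto
    then have "u a = 0" "u a \<in> {- 1, 1}"
      using B(1,2) that independentD[of B B u a] by auto
    then show False
      by simp
  qed
  ultimately have "open (- (\<Union>a\<in>B. S a))" "0 \<in> - (\<Union>a\<in>B. S a)"
    by (blast intro: open_Compl compact_imp_closed)+
  then obtain d where d: "0 < d" "ball 0 d \<subseteq> - (\<Union>a\<in>B. S a)"
    using openE by blast
  have "\<bar>representation B x b\<bar> \<le> (1 / d) * norm x" if b: "b \<in> B" for b x
  proof -
    define m where "m = Max ((\<lambda>b. \<bar>representation B x b\<bar>) ` B)"
    have m_ge: "\<bar>representation B x b\<bar> \<le> m" if "b \<in> B" for b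
      unfolding m_def using B(1) that by (intro Max_ge) auto
    have "m \<in> (\<lambda>b. \<bar>representation B x b\<bar>) ` B"
      unfolding m_def using B(1) b by (intro Max_in) auto
    then obtain a where a: "a \<in> B" "m = \<bar>representation B x a\<bar>"
      by auto
    have "m \<le> (1 / d) * norm x"
    proof (cases "m = 0")
      case True
      then show ?thesis
        using d(1) by simp
    next
      case False
      then have "0 < m"
        using a(2) by simp
      have "(1 / m) *\<^sub>R x = (1 / m) *\<^sub>R (\<Sum>b\<in>B. representation B x b *\<^sub>R b)"
        by (simp only: sum_rep)
      also have "\<dots> = (\<Sum>b\<in>B. (representation B x b / m) *\<^sub>R b)"
        by (simp add: scaleR_sum_right)
      also have "\<dots> \<in> S a"
      proof -
        have "representation B x b / m \<in> (if b = a then {- 1, 1} else {- 1..1})" if "b \<in> B" for b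
        proof (cases "b = a")
          case True
          then show ?thesis
            using a(2) \<open>0 < m\<close> by (auto simp: abs_if split: if_splits)
        next
          case False
          then show ?thesis
            using m_ge[OF that] \<open>0 < m\<close> by (auto simp: field_simps abs_le_iff)
        qed
        then show ?thesis
          unfolding S_def by (intro CollectI exI[of _ "\<lambda>b. representation B x b / m"]) auto
      qed
      finally have "(1 / m) *\<^sub>R x \<notin> ball 0 d"
        using d(2) a(1) by blast
      then show ?thesis
        using \<open>0 < m\<close> d(1) by (simp add: field_simps)
    qed
    then show ?thesis
      using m_ge[OF b] by linarith
  qed
  then show thesis
    by (rule that)
qed

text \<open>By the coordinate bound, the unit ball lies in the image of a compact cube of coordinates, and it is
  closed.\<close>

lemma compact_unit_ball_finite_dim:
  fixes B :: "'a::real_normed_vector set"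
  assumes B: "finite B" "independent B" "span B = UNIV"
  shows "compact (cball (0::'a) 1)"
proof -
  obtain C where C: "\<And>b x. b \<in> B \<Longrightarrow> \<bar>representation B x b\<bar> \<le> C * norm x"
    using representation_bound[OF B] by blast
  let ?K = "{\<Sum>b\<in>B. u b *\<^sub>R b | u. \<forall>b\<in>B. u b \<in> {- \<bar>C\<bar>..\<bar>C\<bar>}}"
  have "cball 0 1 \<subseteq> ?K"
  proof
    fix x :: 'a assume "x \<in> cball 0 1"
    then have "C * norm x \<le> \<bar>C\<bar> * 1"
      by (intro mult_mono) auto
    then have "\<bar>representation B x b\<bar> \<le> \<bar>C\<bar>" if "b \<in> B" for b
      using C[OF that, of x] by linarith
    then have "\<forall>b\<in>B. representation B x b \<in> {- \<bar>C\<bar>..\<bar>C\<bar>}"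
      by (auto simp: abs_le_iff minus_le_iff)
    moreover have "x = (\<Sum>b\<in>B. representation B x b *\<^sub>R b)"
      using B by (intro real_vector.sum_representation_eq[symmetric]) auto
    ultimately show "x \<in> ?K"
      by blast
  qed
  then have "cball 0 1 = ?K \<inter> cball 0 1"
    by blast
  moreover have "compact (?K \<inter> cball 0 1)"
    using B(1) by (intro compact_Int_closed compact_combinations) auto
  ultimately show ?thesis
    by simp
qed

lemma compact_unit_sphere_finite_dim:
  fixes B :: "'a::real_normed_vector set"
  assumes B: "finite B" "independent B" "span B = UNIV"
  shows "compact (sphere (0::'a) 1)"
proof -
  have "sphere (0::'a) 1 = cball 0 1 - ball 0 1"
    by auto
  then show ?thesis
    using compact_unit_ball_finite_dim[OF B] by (simp add: compact_diff)
qed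

lemma functional_attains_norm:
  fixes f :: "'a::real_normed_vector \<Rightarrow> real"
  assumes sphere: "compact (sphere (0::'a) 1)" and f: "bounded_linear f" and w: "f w \<noteq> 0"
  obtains y where "norm y = 1" "0 < f y" "\<And>x. f x \<le> f y * norm x"
proof -
  interpret f: bounded_linear f by fact
  have "w \<noteq> 0"
    using w f.zero by auto
  then have "sgn w \<in> sphere 0 1"
    by (simp add: norm_sgn)
  with sphere obtain y where y: "y \<in> sphere 0 1" "\<And>x. x \<in> sphere 0 1 \<Longrightarrow> f x \<le> f y"
    using continuous_attains_sup[of "sphere 0 1" f] f.continuous_on[OF continuous_on_id] by force
  have le: "f x \<le> f y * norm x" for x
  proof (cases "x = 0")
    case False
    then have "f (sgn x) \<le> f y"
      by (intro y(2)) (simp add: norm_sgn)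
    then show ?thesis
      using False by (simp add: sgn_div_norm f.scaleR field_simps)
  qed (simp add: f.zero)
  have "0 < f y * norm w"
    using le[of w] le[of "- w"] w by (simp add: linear_neg[OF f.linear])
  then have "0 < f y"
    by (simp add: zero_less_mult_iff)
  then show thesis
    using y(1) le by (intro that[of y]) auto
qed

section \<open>Half spaces and ball coverings\<close>

text \<open>For \<open>i \<le> n\<close> the functional \<open>f i\<close> is a coordinate, and \<open>f (n + 1)\<close> is minus the sum of the
  coordinates. If none of them is positive at \<open>z\<close>, the coordinates of \<open>z\<close> are nonpositive with
  nonnegative sum, so \<open>z = 0\<close>. The condition \<open>1 \<le> n\<close> keeps \<open>f (n + 1)\<close> from being the zero
  functional.\<close>

lemma positive_functionals_finite_dim:
  fixes B :: "'a::real_normed_vector set"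
  assumes n: "1 \<le> n" and B: "finite B" "independent B" "span B = UNIV" "card B = n"
  obtains f :: "nat \<Rightarrow> 'a \<Rightarrow> real"
  where "\<And>i. i \<in> {1..n + 1} \<Longrightarrow> bounded_linear (f i)"
    and "\<And>i. i \<in> {1..n + 1} \<Longrightarrow> \<exists>w. f i w \<noteq> 0"
    and "\<And>z. z \<noteq> 0 \<Longrightarrow> \<exists>i\<in>{1..n + 1}. 0 < f i z"
proof -
  obtain e where e: "bij_betw e {1..n} B"
    using ex_bij_betw_nat_finite_1[OF B(1)] B(4) by auto
  have sum_rep: "(\<Sum>b\<in>B. representation B x b *\<^sub>R b) = x" for x
    using B by (intro real_vector.sum_representation_eq) auto
  define f where "f i = (if i \<le> n then (\<lambda>x. representation B x (e i)) else (\<lambda>x. - (\<Sum>b\<in>B. representation B x b)))" for i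
  obtain C where C: "\<And>b x. b \<in> B \<Longrightarrow> \<bar>representation B x b\<bar> \<le> C * norm x"
    using representation_bound[OF B(1-3)] by blast
  have bl: "bounded_linear (\<lambda>x. representation B x b)" if "b \<in> B" for b
    using B C[OF that] by (intro bounded_linear_intro[where K = C])
      (auto simp: real_vector.representation_add real_vector.representation_scale mult.commute)
  show thesis
  proof (rule that[of f])
    fix i assume i: "i \<in> {1..n + 1}"
    show "bounded_linear (f i)"
      using bl e i by (auto simp: f_def bij_betw_def intro!: bounded_linear_minus bounded_linear_sum)
    show "\<exists>w. f i w \<noteq> 0"
    proof (cases "i \<le> n")
      case True
      then have "e i \<in> B"
        using e i by (auto simp: bij_betw_def)
      then show ?thesis
        using True B by (intro exI[of _ "e i"]) (simp add: f_def real_vector.representation_basis)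
    next
      case False
      obtain a where "a \<in> B"
        using n B(4) by fastforce
      then have "(\<Sum>b\<in>B. representation B a b) = 1"
        using B by (simp add: real_vector.representation_basis)
      then show ?thesis
        using False by (intro exI[of _ a]) (simp add: f_def)
    qed
  next
    fix z :: 'a assume "z \<noteq> 0"
    show "\<exists>i\<in>{1..n + 1}. 0 < f i z"
    proof (rule ccontr)
      assume neg: "\<not> ?thesis"
      have coord: "representation B z b \<le> 0" if "b \<in> B" for b
      proof -
        have "b \<in> e ` {1..n}"
          using e \<open>b \<in> B\<close> by (simp add: bij_betw_def)
        then obtain i where "i \<in> {1..n}" "b = e i"
          by blast
        then show ?thesis
          using neg by (force simp: f_def)
      qed
      have "\<not> 0 < f (n + 1) z"
        using neg by auto
      then have "0 \<le> (\<Sum>b\<in>B. representation B z b)"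
        by (simp add: f_def)
      then have "(\<Sum>b\<in>B. - representation B z b) = 0"
        using coord sum_nonpos[of B "representation B z"] by (simp add: sum_negf)
      then have "representation B z b = 0" if "b \<in> B" for b
        using coord that B(1) sum_nonneg_eq_0_iff[of B "\<lambda>b. - representation B z b"] by simp
      then show False
        using sum_rep[of z] \<open>z \<noteq> 0\<close> by simp
    qed
  qed
qed

text \<open>The distance \<open>t - s\<close> of the centers equals the difference of the radii.\<close>

lemma ball_scaleR_mono:
  fixes y :: "'a::real_normed_vector"
  assumes "norm y = 1" and "s \<le> t"
  shows "ball (s *\<^sub>R y) s \<subseteq> ball (t *\<^sub>R y) t"
proof
  fix z assume z: "z \<in> ball (s *\<^sub>R y) s"
  have "dist (t *\<^sub>R y) z \<le> dist (t *\<^sub>R y) (s *\<^sub>R y) + dist (s *\<^sub>R y) z"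
    by (rule dist_triangle)
  also have "dist (t *\<^sub>R y) (s *\<^sub>R y) = t - s"
    using assms by (simp add: dist_norm flip: scaleR_diff_left)
  finally show "z \<in> ball (t *\<^sub>R y) t"
    using z by simp
qed

text \<open>Dividing \<open>norm (y i - s *\<^sub>R z) < 1\<close> by \<open>s\<close> puts \<open>z\<close> into the ball of radius \<open>1 / s\<close> around
  \<open>(1 / s) *\<^sub>R y i\<close>. By compactness finitely many radii suffice, and by monotonicity the largest of
  them serves all directions at once.\<close>

lemma admits_ball_covering_of_directions:
  fixes A :: "'a::real_normed_vector set"
  assumes A: "compact A"
    and y: "\<And>i. i \<in> {1..k} \<Longrightarrow> norm (y i) = 1"
    and descent: "\<And>z. z \<in> A \<Longrightarrow> \<exists>i\<in>{1..k}. \<exists>s>0. norm (y i - s *\<^sub>R z) < 1"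
  shows "admits_ball_covering k A"
proof -
  have "A \<subseteq> (\<Union>t\<in>{0<..}. \<Union>i\<in>{1..k}. ball (t *\<^sub>R y i) t)"
  proof
    fix z assume "z \<in> A"
    then obtain i s where i: "i \<in> {1..k}" "0 < s" "norm (y i - s *\<^sub>R z) < 1"
      using descent by blast
    have "norm ((1 / s) *\<^sub>R y i - z) = norm ((1 / s) *\<^sub>R (y i - s *\<^sub>R z))"
      using i(2) by (simp add: scaleR_diff_right)
    also have "\<dots> = (1 / s) * norm (y i - s *\<^sub>R z)"
      using i(2) by simp
    also have "\<dots> < 1 / s"
      using i(2,3) by (simp add: field_simps)
    finally show "z \<in> (\<Union>t\<in>{0<..}. \<Union>i\<in>{1..k}. ball (t *\<^sub>R y i) t)"
      using i(1,2) by (auto simp: dist_norm intro!: bexI[of _ "1 / s"])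
  qed
  then obtain T where T: "T \<subseteq> {0<..}" "finite T" "A \<subseteq> (\<Union>t\<in>T. \<Union>i\<in>{1..k}. ball (t *\<^sub>R y i) t)"
    by (rule compactE_image[OF A, rotated]) auto
  \<comment> \<open>the extra \<open>1\<close> covers the case that \<open>T\<close> is empty, as it may be for empty \<open>A\<close>\<close>
  define t where "t = Max (insert 1 T)"
  have t: "0 < t" "\<And>s. s \<in> T \<Longrightarrow> s \<le> t"
    using T(2) by (auto simp: t_def Max_gr_iff)
  have "A \<subseteq> (\<Union>i\<in>{1..k}. ball (t *\<^sub>R y i) t)"
    using T(3) ball_scaleR_mono[OF y t(2)] by blast
  moreover have "\<forall>i\<in>{1..k}. t *\<^sub>R y i \<noteq> 0 \<and> 0 < t \<and> t \<le> norm (t *\<^sub>R y i)"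
    using t(1) y by force
  ultimately show ?thesis
    unfolding admits_ball_covering_def
    by (intro exI[of _ "\<lambda>i. t *\<^sub>R y i"] exI[of _ "\<lambda>_. t"]) blast
qed

theorem corollary3p26:
  fixes n :: nat
  assumes "n \<ge> 1"
    and "dim (UNIV :: 'a::banach set) = n"
    and "smooth_space TYPE('a)"
  shows "(\<forall>A :: 'a set. compact A \<and> A \<subseteq> UNIV - {0} \<longrightarrow> admits_ball_covering (n + 1) A)
    \<and> admits_ball_covering (n + 1) (sphere (0::'a) 1)"
proof -
  obtain B :: "'a set" where "independent B" "UNIV \<subseteq> span B" "card B = dim (UNIV :: 'a set)"
    by (rule real_vector.basis_exists)
  then have B: "finite B" "independent B" "span B = UNIV" "card B = n"
    using assms(1,2) by (auto intro: card_ge_0_finite)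
  have sphere: "compact (sphere (0::'a) 1)"
    using B(1-3) by (rule compact_unit_sphere_finite_dim)
  obtain f :: "nat \<Rightarrow> 'a \<Rightarrow> real"
    where f: "\<And>i. i \<in> {1..n + 1} \<Longrightarrow> bounded_linear (f i)"
      "\<And>i. i \<in> {1..n + 1} \<Longrightarrow> \<exists>w. f i w \<noteq> 0"
      "\<And>z. z \<noteq> 0 \<Longrightarrow> \<exists>i\<in>{1..n + 1}. 0 < f i z"
    using positive_functionals_finite_dim[OF assms(1) B] by blast
  have "\<exists>y. norm y = 1 \<and> 0 < f i y \<and> (\<forall>x. f i x \<le> f i y * norm x)" if "i \<in> {1..n + 1}" for i
    using functional_attains_norm[OF sphere f(1)[OF that]] f(2)[OF that] by metis
  then obtain y where y: "\<And>i. i \<in> {1..n + 1} \<Longrightarrow>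
      norm (y i) = 1 \<and> 0 < f i (y i) \<and> (\<forall>x. f i x \<le> f i (y i) * norm x)"
    by metis
  have descent: "\<exists>i\<in>{1..n + 1}. \<exists>s>0. norm (y i - s *\<^sub>R z) < 1" if z: "z \<noteq> 0" for z
  proof -
    obtain i where i: "i \<in> {1..n + 1}" "0 < f i z"
      using f(3)[OF z] by blast
    \<comment> \<open>the support functional at \<open>y i\<close>\<close>
    define g where "g x = f i x / f i (y i)" for x
    have "bounded_linear g"
      unfolding g_def using bounded_linear_compose[OF bounded_linear_divide f(1)[OF i(1)]] by simp
    then have "linear g"
      by (rule bounded_linear.linear)
    moreover have "g x \<le> norm x" for x
      using y[OF i(1)] by (simp add: g_def field_simps)
    moreover have "norm (y i) = 1" "g (y i) = 1" "0 < g z"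
      using y[OF i(1)] i(2) by (auto simp: g_def)
    ultimately obtain s where "0 < s" "norm (y i - s *\<^sub>R z) < 1"
      using smooth_norm_descent[OF assms(3) B(1) B(3)] by blast
    then show ?thesis
      using i(1) by blast
  qed
  have covering: "admits_ball_covering (n + 1) A" if "compact A" "A \<subseteq> UNIV - {0}" for A :: "'a set"
  proof (rule admits_ball_covering_of_directions[OF that(1)])
    show "norm (y i) = 1" if "i \<in> {1..n + 1}" for i
      using y[OF that] by blast
    show "\<exists>i\<in>{1..n + 1}. \<exists>s>0. norm (y i - s *\<^sub>R z) < 1" if "z \<in> A" for z
      using descent that \<open>A \<subseteq> UNIV - {0}\<close> by blast
  qed
  have "admits_ball_covering (n + 1) (sphere (0::'a) 1)"
    using sphere by (rule covering) auto
  then show ?thesis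
    using covering by blast
qed

end
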